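(* Assume that for an $m$ with $1\le m\le k_{\max}$ the condition $$\max\{\Phi_{h,m},\,c_F\tilde\lambda_{k_{\max}}\Phi_{h,m}\}\le\tfrac12$$ is satisfied. Then for all $1\le j\le m$: $$\tilde\lambda_j\ge(1-2\alpha_h)(1-2\beta_h)\big(1+\hat c(\tilde\alpha_h+\tilde\beta_h)\Phi_{h,m}\big)^{-2}\big(1-c_F^2\tilde\lambda_{k_{\max}}\Phi_{h,m}^2\big)\lambda_j,\qquad\hat c:=\frac{8}{\sqrt3}\,c_F\,\lambda_{k_{\max}}^{1/2}.$$
   Context: Setting. $H\subset\hat H$ are infinite-dimensional real Hilbert spaces, $H$ compactly embedded in $\hat H$; $a:H\times H\to\mathbb R$ is a bounded symmetric elliptic bilinear form; $b(\cdot,\cdot)$ is the scalar product of $\hat H$. Let $0<\lambda_1\le\lambda_2\le\dots$ be the eigenvalues (with multiplicity, tending to infinity) and $u_1,u_2,\ldots\in H$ corresponding eigenvectors of $a(u,v)=\lambda b(u,v)$ for all $v\in H$, with $a(u_k,u_\ell)=\lambda_k\delta_{k\ell}$, $b(u_k,u_\ell)=\delta_{k\ell}$. Fix $k_{\max}\in\mathbb N$. $H^{\rm ex}$ is a further real vector space, $\mathcal E:H\to H^{\rm ex}$ is a linear injective extension operator, and $\mathcal E_h^{-\ell}:H^{\rm ex}\to H$ is a linear operator with $\mathcal E_h^{-\ell}\mathcal E={\rm id}_H$. Write $u^e:=\mathcal E u$ and $U_j^e:={\rm span}\{u_1^e,\dots,u_j^e\}$. $V_h\subset H^{\rm ex}$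 is a finite-dimensional subspace, $n:=\dim V_h\ge k_{\max}$. On $H^{\rm ex}\times H^{\rm ex}$ there are bilinear forms $a_h=\tilde a_h+k_a$, $b_h=\tilde b_h+k_b$ with $\tilde a_h,\tilde b_h,k_a,k_b$ symmetric positive semidefinite, and $a_h,b_h$ are positive definite on $V_h$; $|||u|||_h:=a_h(u,u)^{1/2}$, $\|u\|_h:=b_h(u,u)^{1/2}$ denote the seminorms. Discrete eigenproblem: $\tilde u_1,\dots,\tilde u_n\in V_h$ is a basis of $V_h$ and $0<\tilde\lambda_1\le\dots\le\tilde\lambda_n$ are such that $a_h(\tilde u_k,\tilde u_\ell)=\tilde\lambda_k\delta_{k\ell}$, $b_h(\tilde u_k,\tilde u_\ell)=\delta_{k\ell}$. Set $\tilde U_m:={\rm span}\{\tilde u_1,\dots,\tilde u_m\}$. Consistency assumptions. (i) There are $\alpha_{h,1},\alpha_{h,2},\beta_{h,1},\beta_{h,2}<1$, tending to $0$ as $h\downarrow0$, such that for all $u,v\in U_{k_{\max}}^e$: $|\tilde a_h(u,v)-a(\mathcal E_h^{-\ell}u,\mathcal E_h^{-\ell}v)|\le\alpha_{h,1}|||u|||_h|||v|||_h$, $|k_a(u,v)|\le\alpha_{h,2}|||u|||_h|||v|||_h$, $|\tilde b_h(u,v)-b(\mathcal E_h^{-\ell}u,\mathcal E_h^{-\ell}v)|\le\beta_{h,1}\|u\|_h\|v\|_h$, $|k_b(u,v)|\le\beta_{h,2}\|u\|_h\|v\|_h$. Set $\alpha_h:=\alpha_{h,1}+\alpha_{h,2}$,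 $\beta_h:=\beta_{h,1}+\beta_{h,2}$. (ii) There are $\tilde\alpha_h,\tilde\beta_h<1$, tending to $0$ as $h\downarrow0$, such that for all $u\in U_{k_{\max}}^e$, $v\in V_h+U_{k_{\max}}^e$: $|a_h(u,v)-a(\mathcal E_h^{-\ell}u,\mathcal E_h^{-\ell}v)|\le\tilde\alpha_h|||u|||_h|||v|||_h$, $|b_h(u,v)-b(\mathcal E_h^{-\ell}u,\mathcal E_h^{-\ell}v)|\le\tilde\beta_h\|u\|_h\|v\|_h$. It is assumed throughout that $\alpha_h,\beta_h,\tilde\alpha_h,\tilde\beta_h<\tfrac12$. (These imply that $|||\cdot|||_h$ is a norm on $U_{k_{\max}}^e$.) Friedrichs assumption: there is $c_F>0$, independent of $h$, with $\|v\|_h\le c_F|||v|||_h$ for all $v\in V_h+U_{k_{\max}}^e$. $P_{a_h,m}:H^{\rm ex}\to U_m^e$ is the $a_h$-orthogonal projection onto $U_m^e$, and $$\Phi_{h,m}:=\max_{0\ne w\in\tilde U_m}\frac{|||w-P_{a_h,m}w|||_h}{|||w|||_h},\qquad1\le m\le k_{\max}.$$ *)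

theory Defs
  imports "HOL-Analysis.Analysis"
begin

definition finite_dimensional :: "'a::real_vector set \<Rightarrow> bool" where
  "finite_dimensional S \<longleftrightarrow> (\<exists>B. finite B \<and> S \<subseteq> span B)"

text \<open>The inclusion of \<open>H\<close> into the larger space is represented by an injective bounded
  linear map between two Hilbert space types.\<close>

definition compact_embedding :: "('a::real_normed_vector \<Rightarrow> 'b::real_normed_vector) \<Rightarrow> bool" where
  "compact_embedding \<iota> \<longleftrightarrow>
     bounded_linear \<iota> \<and> inj \<iota> \<and> (\<forall>S. bounded S \<longrightarrow> compact (closure (\<iota> ` S)))"

definition symmetric_form :: "('a \<Rightarrow> 'a \<Rightarrow> real) \<Rightarrow> bool" where
  "symmetric_form A \<longleftrightarrow> (\<forall>x y. A x y = A y x)"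

definition elliptic_form :: "('a::real_normed_vector \<Rightarrow> 'a \<Rightarrow> real) \<Rightarrow> bool" where
  "elliptic_form A \<longleftrightarrow> (\<exists>c>0. \<forall>x. c * (norm x)\<^sup>2 \<le> A x x)"

definition positive_semidefinite :: "('a \<Rightarrow> 'a \<Rightarrow> real) \<Rightarrow> bool" where
  "positive_semidefinite A \<longleftrightarrow> (\<forall>x. 0 \<le> A x x)"

definition positive_definite_on :: "'a::zero set \<Rightarrow> ('a \<Rightarrow> 'a \<Rightarrow> real) \<Rightarrow> bool" where
  "positive_definite_on S A \<longleftrightarrow> (\<forall>x\<in>S. x \<noteq> 0 \<longrightarrow> 0 < A x x)"

definition eigenspace ::
  "('a \<Rightarrow> 'a \<Rightarrow> real) \<Rightarrow> ('a \<Rightarrow> 'a \<Rightarrow> real) \<Rightarrow> real \<Rightarrow> 'a set" where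
  "eigenspace A B \<mu> = {w. \<forall>v. A w v = \<mu> * B w v}"

definition seminorm_of :: "('a \<Rightarrow> 'a \<Rightarrow> real) \<Rightarrow> 'a \<Rightarrow> real" where
  "seminorm_of A x = sqrt (A x x)"

text \<open>Well defined if \<open>A\<close> is an inner product on the finite-dimensional subspace \<open>U\<close>;
  \<open>A\<close> may be degenerate on the whole space.\<close>

definition form_projection ::
  "('a::real_vector \<Rightarrow> 'a \<Rightarrow> real) \<Rightarrow> 'a set \<Rightarrow> 'a \<Rightarrow> 'a" where
  "form_projection A U w = (THE p. p \<in> U \<and> (\<forall>v\<in>U. A (w - p) v = 0))"

text \<open>For finite-dimensional \<open>W \<noteq> {0}\<close> on which \<open>A\<close> is positive definite the supremum is a
  maximum, since the quotient is continuous and invariant under scaling.\<close>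

definition projection_defect ::
  "('a::real_vector \<Rightarrow> 'a \<Rightarrow> real) \<Rightarrow> 'a set \<Rightarrow> 'a set \<Rightarrow> real" where
  "projection_defect A U W =
     (SUP w\<in>W - {0}. seminorm_of A (w - form_projection A U w) / seminorm_of A w)"

end

theory Submission
  imports Defs
begin

text \<open>Since \<open>j\<close> unknowns satisfy \<open>j - 1\<close> linear conditions, some \<open>w \<noteq> 0\<close> in the span of the
  first \<open>j\<close> discrete eigenvectors has a projection \<open>x = P w\<close> whose lift to \<open>H\<close> is
  \<open>b\<close>-orthogonal to \<open>u\<^sub>1, \<dots>, u\<^bsub>j-1\<^esub>\<close>; hence \<open>\<lambda>\<^sub>j\<close> is at most the Rayleigh quotient of that lift.
  Its numerator is controlled by consistency and \<open>a\<^sub>h(x,x) \<le> a\<^sub>h(w,w)\<close>. For the denominator,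
  write \<open>w = x + r\<close>: the Friedrichs inequality makes \<open>b\<^sub>h(r,r)\<close> of order \<open>\<Phi>\<^sup>2\<close>, and the cross term
  \<open>b\<^sub>h(x,r)\<close> is small because \<open>b(x,\<cdot>) = a(y,\<cdot>)\<close> for some \<open>y\<close> in the range of \<open>P\<close>, to
  which \<open>r\<close> is \<open>a\<^sub>h\<close>-orthogonal.\<close>

section \<open>Linear algebra\<close>

text \<open>Gaussian elimination, by induction on the equations: a zero row is dropped, any other
  row is solved for a pivot unknown \<open>p\<close>, which lowers both cardinalities by
  one.\<close>

lemma underdetermined_system:
  fixes M :: "'i \<Rightarrow> 'j \<Rightarrow> real"
  assumes "finite I" "finite J" "card I < card J"
  shows "\<exists>d. (\<exists>k\<in>J. d k \<noteq> 0) \<and> (\<forall>i\<in>I. (\<Sum>k\<in>J. d k * M i k) = 0)"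
  using assms
proof (induction I arbitrary: J M rule: finite_induct)
  case empty
  then obtain k where "k \<in> J" by fastforce
  then show ?case by (intro exI[of _ "\<lambda>_. 1"]) auto
next
  case (insert i I)
  show ?case
  proof (cases "\<forall>k\<in>J. M i k = 0")
    case True
    have "card I < card J" using insert.prems insert.hyps by simp
    then obtain d where "\<exists>k\<in>J. d k \<noteq> 0" "\<forall>l\<in>I. (\<Sum>k\<in>J. d k * M l k) = 0"
      using insert.IH[of J M] insert.prems by blast
    then show ?thesis using True by (intro exI[of _ d]) simp
  next
    case False
    then obtain p where p: "p \<in> J" "M i p \<noteq> 0" by blast
    \<comment> \<open>Row \<open>l\<close> after elimination of the unknown \<open>p\<close> by
      means of row \<open>i\<close>; for \<open>l = i\<close> this row is zero.\<close>
    define M' where "M' = (\<lambda>l k. M l k - M l p * M i k / M i p)"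
    have "card I < card (J - {p})"
      using insert.prems insert.hyps p by simp
    then obtain d where d: "\<exists>k\<in>J - {p}. d k \<noteq> 0"
        "\<And>l. l \<in> I \<Longrightarrow> (\<Sum>k\<in>J - {p}. d k * M' l k) = 0"
      using insert.IH[of "J - {p}" M'] insert.prems by auto
    \<comment> \<open>The value at \<open>p\<close> is the one that equation \<open>i\<close>
      dictates once the other unknowns are given.\<close>
    define e where "e = d(p := - (\<Sum>k\<in>J - {p}. d k * M i k) / M i p)"
    have e_sum: "(\<Sum>k\<in>J. e k * M l k) = (\<Sum>k\<in>J - {p}. d k * M' l k)" for l
    proof -
      have "(\<Sum>k\<in>J. e k * M l k) = e p * M l p + (\<Sum>k\<in>J - {p}. d k * M l k)"
        unfolding e_def using p insert.prems by (subst sum.remove[of J p]) auto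
      also have "\<dots> = (\<Sum>k\<in>J - {p}. d k * M' l k)"
        unfolding e_def M'_def using p
        by (simp add: right_diff_distrib sum_subtractf sum_distrib_left sum_divide_distrib mult_ac)
      finally show ?thesis .
    qed
    have "(\<Sum>k\<in>J. e k * M i k) = 0"
      unfolding e_sum M'_def using p by simp
    moreover have "\<exists>k\<in>J. e k \<noteq> 0"
      using d(1) unfolding e_def by auto
    ultimately show ?thesis
      using d(2) e_sum by (intro exI[of _ e]) auto
  qed
qed

text \<open>The coefficients are indexed by \<open>I\<close> and not by vectors, so \<open>f\<close>
  may repeat values.\<close>

lemma span_image_sum:
  fixes f :: "'i \<Rightarrow> 'e::real_vector"
  assumes "finite I"
  shows "span (f ` I) = range (\<lambda>c. \<Sum>i\<in>I. c i *\<^sub>R f i)"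
proof
  have "f i \<in> range (\<lambda>c. \<Sum>i\<in>I. c i *\<^sub>R f i)" if "i \<in> I" for i
    by (rule image_eqI[of _ _ "\<lambda>l. if l = i then 1 else 0"])
      (use assms that in \<open>auto simp: if_distrib[of "\<lambda>t. t *\<^sub>R _"] cong: if_cong\<close>)
  moreover have "subspace (range (\<lambda>c. \<Sum>i\<in>I. c i *\<^sub>R f i))"
  proof (rule subspaceI)
    show "0 \<in> range (\<lambda>c. \<Sum>i\<in>I. c i *\<^sub>R f i)"
      by (rule image_eqI[of _ _ "\<lambda>_. 0"]) auto
    fix x y assume "x \<in> range (\<lambda>c. \<Sum>i\<in>I. c i *\<^sub>R f i)" "y \<in> range (\<lambda>c. \<Sum>i\<in>I. c i *\<^sub>R f i)"
    then obtain c d where "x = (\<Sum>i\<in>I. c i *\<^sub>R f i)" "y = (\<Sum>i\<in>I. d i *\<^sub>R f i)" by blast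
    then show "x + y \<in> range (\<lambda>c. \<Sum>i\<in>I. c i *\<^sub>R f i)"
      by (intro image_eqI[of _ _ "\<lambda>i. c i + d i"]) (auto simp: scaleR_left_distrib sum.distrib)
  next
    fix t x assume "x \<in> range (\<lambda>c. \<Sum>i\<in>I. c i *\<^sub>R f i)"
    then obtain c where "x = (\<Sum>i\<in>I. c i *\<^sub>R f i)" by blast
    then show "t *\<^sub>R x \<in> range (\<lambda>c. \<Sum>i\<in>I. c i *\<^sub>R f i)"
      by (intro image_eqI[of _ _ "\<lambda>i. t * c i"]) (auto simp: scaleR_sum_right)
  qed
  ultimately show "span (f ` I) \<subseteq> range (\<lambda>c. \<Sum>i\<in>I. c i *\<^sub>R f i)"
    by (intro span_minimal) auto
  show "range (\<lambda>c. \<Sum>i\<in>I. c i *\<^sub>R f i) \<subseteq> span (f ` I)"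
    by (intro image_subsetI span_sum span_scale span_base imageI)
qed

lemma bilinear_sum_left:
  fixes A :: "'e::real_vector \<Rightarrow> 'f::real_vector \<Rightarrow> real"
  assumes "bilinear A"
  shows "A (\<Sum>i\<in>I. c i *\<^sub>R f i) v = (\<Sum>i\<in>I. c i * A (f i) v)"
proof -
  interpret linear "\<lambda>x. A x v" using assms by (simp add: bilinear_def)
  show ?thesis by (simp add: sum scale)
qed

lemma bilinear_sum_right:
  fixes A :: "'e::real_vector \<Rightarrow> 'f::real_vector \<Rightarrow> real"
  assumes "bilinear A"
  shows "A v (\<Sum>i\<in>I. c i *\<^sub>R f i) = (\<Sum>i\<in>I. c i * A v (f i))"
proof -
  interpret linear "A v" using assms by (simp add: bilinear_def)
  show ?thesis by (simp add: sum scale)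
qed

lemma bilinear_sum_orthogonal:
  fixes A :: "'e::real_vector \<Rightarrow> 'e \<Rightarrow> real"
  assumes "bilinear A" "finite I"
    and "\<And>i l. i \<in> I \<Longrightarrow> l \<in> I \<Longrightarrow> A (f i) (f l) = (if i = l then \<mu> i else 0)"
  shows "A (\<Sum>i\<in>I. c i *\<^sub>R f i) (\<Sum>i\<in>I. d i *\<^sub>R f i) = (\<Sum>i\<in>I. \<mu> i * c i * d i)"
proof -
  have "A (\<Sum>i\<in>I. c i *\<^sub>R f i) (\<Sum>i\<in>I. d i *\<^sub>R f i) = (\<Sum>i\<in>I. c i * (\<Sum>l\<in>I. d l * A (f i) (f l)))"
    by (subst bilinear_sum_left[OF assms(1)]) (simp only: bilinear_sum_right[OF assms(1)])
  also have "\<dots> = (\<Sum>i\<in>I. c i * (\<Sum>l\<in>I. if i = l then d i * \<mu> i else 0))"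
    by (intro sum.cong arg_cong2[where f = "(*)"] refl) (auto simp: assms(3))
  also have "\<dots> = (\<Sum>i\<in>I. \<mu> i * c i * d i)"
    using assms(2) by (simp add: mult_ac)
  finally show ?thesis .
qed

section \<open>Orthogonal projections with respect to a bilinear form\<close>

text \<open>Gram-Schmidt, by induction on the generators. A generator that coincides with its own
  projection enlarges nothing; any other contributes a new orthogonal direction.\<close>

lemma form_projection_exists:
  fixes A :: "'e::real_vector \<Rightarrow> 'e \<Rightarrow> real"
  assumes bil: "bilinear A" and "finite S"
    and pos: "positive_definite_on (span S) A"
  shows "\<exists>p\<in>span S. \<forall>v\<in>span S. A (w - p) v = 0"
  using \<open>finite S\<close> pos
proof (induction S arbitrary: w rule: finite_induct)
  case empty
  then show ?case by (simp add: bilinear_rzero[OF bil])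
next
  case (insert c S)
  have sub: "span S \<subseteq> span (insert c S)" by (rule span_mono) auto
  then have pos: "positive_definite_on (span S) A"
    using insert.prems by (auto simp: positive_definite_on_def)
  obtain q where q: "q \<in> span S" "\<And>v. v \<in> span S \<Longrightarrow> A (c - q) v = 0"
    using insert.IH[OF pos, of c] by blast
  obtain p where p: "p \<in> span S" "\<And>v. v \<in> span S \<Longrightarrow> A (w - p) v = 0"
    using insert.IH[OF pos, of w] by blast
  show ?case
  proof (cases "c - q = 0")
    case True
    then have "span (insert c S) = span S" using q(1) by (simp add: span_redundant)
    then show ?thesis using p by auto
  next
    case False
    define e where "e = c - q"
    have e: "e \<in> span (insert c S)"
      unfolding e_def using q(1) sub by (auto intro: span_diff span_base)
    then have e_pos: "A e e > 0"
      using insert.prems False by (simp add: positive_definite_on_def e_def)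
    \<comment> \<open>The coefficient of the remaining error \<open>w - p\<close> along the new
      direction \<open>e\<close>.\<close>
    define t where "t = A (w - p) e / A e e"
    have "A (w - (p + t *\<^sub>R e)) v = 0" if v: "v \<in> span (insert c S)" for v
    proof -
      obtain s where s: "v - s *\<^sub>R c \<in> span S"
        using v by (auto simp: span_breakdown_eq)
      \<comment> \<open>Trading \<open>c\<close> for \<open>e = c - q\<close> splits
        \<open>v\<close> as \<open>v' + s *\<^sub>R e\<close> with \<open>v'\<close> in the old
        span, where both old orthogonality relations apply.\<close>
      define v' where "v' = v - s *\<^sub>R c + s *\<^sub>R q"
      have v': "v' \<in> span S" unfolding v'_def using s q(1) by (intro span_add span_scale)
      have "v = v' + s *\<^sub>R e" by (simp add: v'_def e_def algebra_simps)
      then have "A (w - (p + t *\<^sub>R e)) v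
          = A (w - p) v' + s * A (w - p) e - t * (A e v' + s * A e e)"
        by (simp add: bilinear_ladd[OF bil] bilinear_lsub[OF bil] bilinear_radd[OF bil]
            bilinear_lmul[OF bil] bilinear_rmul[OF bil] algebra_simps)
      also have "\<dots> = 0"
        using p(2)[OF v'] q(2)[OF v'] e_pos by (simp add: t_def e_def)
      finally show ?thesis .
    qed
    moreover have "p + t *\<^sub>R e \<in> span (insert c S)"
      using p(1) sub e by (auto intro: span_add span_scale)
    ultimately show ?thesis by blast
  qed
qed

text \<open>The difference of two candidates lies in \<open>U\<close> and is
  \<open>A\<close>-orthogonal to itself. This makes the definite description usable.\<close>

lemma form_projection_unique:
  fixes A :: "'e::real_vector \<Rightarrow> 'e \<Rightarrow> real"
  assumes bil: "bilinear A" and U: "subspace U" and pos: "positive_definite_on U A"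
    and p: "p \<in> U" "\<And>v. v \<in> U \<Longrightarrow> A (w - p) v = 0"
  shows "form_projection A U w = p"
  unfolding form_projection_def
proof (rule the_equality)
  show "p \<in> U \<and> (\<forall>v\<in>U. A (w - p) v = 0)" using p by blast
  fix q assume q: "q \<in> U \<and> (\<forall>v\<in>U. A (w - q) v = 0)"
  have "q - p \<in> U" using U p(1) q by (simp add: subspace_diff)
  then have "A (w - p) (q - p) - A (w - q) (q - p) = 0" using p(2) q by simp
  then have "A (q - p) (q - p) = 0"
    by (simp add: bilinear_lsub[OF bil])
  then show "q = p"
    using pos \<open>q - p \<in> U\<close> by (force simp: positive_definite_on_def)
qed

locale form_projector =
  fixes A :: "'e::real_vector \<Rightarrow> 'e \<Rightarrow> real" and S :: "'e set"
  assumes bil: "bilinear A" and sym: "symmetric_form A" and psd: "positive_semidefinite A"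
    and fin: "finite S" and pos: "positive_definite_on (span S) A"
begin

abbreviation P :: "'e \<Rightarrow> 'e" where "P \<equiv> form_projection A (span S)"

lemma P_in [simp]: "P w \<in> span S"
  and P_orth: "v \<in> span S \<Longrightarrow> A (w - P w) v = 0"
  using form_projection_exists[OF bil fin pos, of w]
    form_projection_unique[OF bil subspace_span pos, of _ w] by auto

lemma P_pythagoras: "A w w = A (P w) (P w) + A (w - P w) (w - P w)"
proof -
  have 1: "A (w - P w) (P w) = 0" by (simp add: P_orth)
  have 2: "A (P w) (w - P w) = 0" using 1 sym by (simp add: symmetric_form_def)
  have "A w w = A (P w + (w - P w)) (P w + (w - P w))" by simp
  then show ?thesis
    using 1 2 by (simp only: bilinear_ladd[OF bil] bilinear_radd[OF bil])
qed

text \<open>Linearity follows from uniqueness: the combination of the projections satisfies the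
  defining orthogonality. It turns conditions on \<open>P w\<close> into linear equations for the
  coefficients of \<open>w\<close>.\<close>

lemma P_sum: "P (\<Sum>i\<in>I. c i *\<^sub>R f i) = (\<Sum>i\<in>I. c i *\<^sub>R P (f i))"
proof (rule form_projection_unique[OF bil subspace_span pos])
  fix v assume v: "v \<in> span S"
  have "A ((\<Sum>i\<in>I. c i *\<^sub>R f i) - (\<Sum>i\<in>I. c i *\<^sub>R P (f i))) v
      = A (\<Sum>i\<in>I. c i *\<^sub>R (f i - P (f i))) v"
    by (simp add: sum_subtractf scaleR_diff_right)
  also have "\<dots> = 0" using v by (simp add: bilinear_sum_left[OF bil] P_orth)
  finally show "A ((\<Sum>i\<in>I. c i *\<^sub>R f i) - (\<Sum>i\<in>I. c i *\<^sub>R P (f i))) v = 0" .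
qed (intro span_sum span_scale P_in)

text \<open>A real supremum dominates its members only if the set is bounded above; by Pythagoras
  every quotient is at most 1.\<close>

lemma projection_defect_bound:
  assumes W: "positive_definite_on W A" and w: "w \<in> W" "w \<noteq> 0"
  shows "seminorm_of A (w - P w) \<le> projection_defect A (span S) W * seminorm_of A w"
    and "0 \<le> projection_defect A (span S) W"
proof -
  \<comment> \<open>This includes vectors of zero seminorm, for which the quotient is 0 by
    convention.\<close>
  have "seminorm_of A (v - P v) / seminorm_of A v \<le> 1" for v
  proof -
    have "A (v - P v) (v - P v) \<le> A v v"
      using P_pythagoras[of v] psd by (simp add: positive_semidefinite_def)
    then have "seminorm_of A (v - P v) \<le> seminorm_of A v" by (simp add: seminorm_of_def)
    moreover have "0 \<le> seminorm_of A v"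
      using psd by (simp add: seminorm_of_def positive_semidefinite_def)
    ultimately show ?thesis by (auto simp: divide_le_eq_1)
  qed
  then have "bdd_above ((\<lambda>v. seminorm_of A (v - P v) / seminorm_of A v) ` (W - {0}))"
    by (intro bdd_aboveI2[where M = 1])
  then have *: "seminorm_of A (w - P w) / seminorm_of A w \<le> projection_defect A (span S) W"
    unfolding projection_defect_def using w by (intro cSUP_upper) auto
  have "seminorm_of A w > 0"
    using W w by (simp add: positive_definite_on_def seminorm_of_def)
  with * show "seminorm_of A (w - P w) \<le> projection_defect A (span S) W * seminorm_of A w"
    by (simp add: divide_le_eq)
  have "0 \<le> seminorm_of A (w - P w) / seminorm_of A w"
    using psd by (simp add: positive_semidefinite_def seminorm_of_def)
  with * show "0 \<le> projection_defect A (span S) W" by linarith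
qed

end

section \<open>A scalar inequality for the consistency constants\<close>

text \<open>The cross term carries the constant \<open>q * sqrt q\<close>, which can exceed \<open>4\<close> when \<open>\<alpha>\<close> and \<open>\<beta>\<close> are
  close to \<open>1/2\<close>. This is compensated by \<open>(1 - 2\<alpha>)(1 - 2\<beta>)\<close> being smaller than the factor
  \<open>(1 - \<beta>)/(1 + \<alpha>)\<close> that the Rayleigh quotient produces.\<close>

lemma consistency_constants:
  fixes \<alpha> \<beta> :: real
  assumes \<alpha>: "0 \<le> \<alpha>" "\<alpha> < 1/2" and \<beta>: "0 \<le> \<beta>" "\<beta> < 1/2"
  defines "q \<equiv> (1 + \<beta>) / (1 - \<alpha>)" and "\<kappa> \<equiv> (1 - 2 * \<alpha>) * (1 - 2 * \<beta>) * (1 + \<alpha>)"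
  shows "0 < \<kappa>" and "\<kappa> \<le> 1 - \<beta>" and "\<kappa> * (q * sqrt q) \<le> 4 * (1 - \<beta>)"
proof -
  show "0 < \<kappa>" using assms by (simp add: \<kappa>_def)
  have a1: "(1 - 2 * \<alpha>) * (1 + \<alpha>) \<le> (1 - \<alpha>) * 1"
    using \<alpha> by (simp add: algebra_simps)
  have b1: "(1 - 2 * \<beta>) * (1 + \<beta>) \<le> (1 - \<beta>) * 1"
    using \<beta> by (simp add: algebra_simps)
  have "\<kappa> = ((1 - 2 * \<alpha>) * (1 + \<alpha>)) * (1 - 2 * \<beta>)" by (simp add: \<kappa>_def)
  also have "\<dots> \<le> 1 * (1 - \<beta>)"
    using a1 \<alpha> \<beta> by (intro mult_mono) auto
  finally show "\<kappa> \<le> 1 - \<beta>" by simp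
  \<comment> \<open>Squaring removes \<open>sqrt q\<close>, and the claim then splits into an
    estimate in \<alpha> and one in \<beta>. Each costs a factor 2, so the product 4 stays below the
    available 16.\<close>
  have a2: "((1 - 2 * \<alpha>) * (1 + \<alpha>))\<^sup>2 \<le> 2 * (1 - \<alpha>) ^ 3"
  proof -
    have "1 - 2 * \<alpha> \<le> (1 - \<alpha>)\<^sup>2" by (simp add: power2_eq_square algebra_simps)
    then have "(1 - 2 * \<alpha>)\<^sup>2 \<le> ((1 - \<alpha>)\<^sup>2)\<^sup>2" using \<alpha> by (intro power_mono) auto
    then have "((1 - 2 * \<alpha>) * (1 + \<alpha>))\<^sup>2 \<le> ((1 - \<alpha>)\<^sup>2)\<^sup>2 * (1 + \<alpha>)\<^sup>2"
      by (simp add: power_mult_distrib mult_right_mono)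
    also have "\<dots> = (1 - \<alpha>) ^ 3 * ((1 + \<alpha>) * (1 - \<alpha>\<^sup>2))" by (simp add: power2_eq_square power3_eq_cube algebra_simps)
    also have "\<dots> \<le> (1 - \<alpha>) ^ 3 * (2 * 1)"
      using \<alpha> by (intro mult_left_mono mult_mono) (auto simp: power_le_one)
    finally show ?thesis by simp
  qed
  have b2: "(1 - 2 * \<beta>)\<^sup>2 * (1 + \<beta>) ^ 3 \<le> 2 * (1 - \<beta>)\<^sup>2"
  proof -
    have "(1 - 2 * \<beta>)\<^sup>2 * (1 + \<beta>) ^ 3 = ((1 - 2 * \<beta>) * (1 + \<beta>))\<^sup>2 * (1 + \<beta>)" by (simp add: power2_eq_square power3_eq_cube algebra_simps)
    also have "\<dots> \<le> (1 - \<beta>)\<^sup>2 * 2"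
      using b1 \<beta> by (intro mult_mono power_mono) auto
    finally show ?thesis by simp
  qed
  have "\<kappa>\<^sup>2 * (1 + \<beta>) ^ 3
      = ((1 - 2 * \<alpha>) * (1 + \<alpha>))\<^sup>2 * ((1 - 2 * \<beta>)\<^sup>2 * (1 + \<beta>) ^ 3)"
    by (simp add: \<kappa>_def power_mult_distrib)
  also have "\<dots> \<le> (2 * (1 - \<alpha>) ^ 3) * (2 * (1 - \<beta>)\<^sup>2)"
    using \<alpha> \<beta> by (intro mult_mono[OF a2 b2] mult_nonneg_nonneg zero_le_power) auto
  also have "\<dots> = 4 * ((1 - \<beta>)\<^sup>2 * (1 - \<alpha>) ^ 3)" by simp
  also have "\<dots> \<le> 16 * ((1 - \<beta>)\<^sup>2 * (1 - \<alpha>) ^ 3)"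
    using \<alpha> \<beta> by (intro mult_right_mono mult_nonneg_nonneg zero_le_power) auto
  finally have "\<kappa>\<^sup>2 * (1 + \<beta>) ^ 3 \<le> 16 * (1 - \<beta>)\<^sup>2 * (1 - \<alpha>) ^ 3"
    by (simp only: mult.assoc)
  then have q3: "\<kappa>\<^sup>2 * q ^ 3 \<le> 16 * (1 - \<beta>)\<^sup>2"
    using \<alpha> by (simp add: q_def power_divide divide_le_eq)
  have "0 \<le> q" using \<alpha> \<beta> by (simp add: q_def)
  then have "(\<kappa> * (q * sqrt q))\<^sup>2 = \<kappa>\<^sup>2 * q ^ 3"
    by (simp add: power_mult_distrib power2_eq_square power3_eq_cube)
  also note q3
  also have "16 * (1 - \<beta>)\<^sup>2 = (4 * (1 - \<beta>))\<^sup>2"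
    by (simp add: power2_eq_square algebra_simps)
  finally have "(\<kappa> * (q * sqrt q))\<^sup>2 \<le> (4 * (1 - \<beta>))\<^sup>2" .
  then show "\<kappa> * (q * sqrt q) \<le> 4 * (1 - \<beta>)"
    by (rule power2_le_imp_le) (use \<beta> in auto)
qed

section \<open>The perturbed eigenproblem\<close>

lemma seminorm_of_squared: "positive_semidefinite A \<Longrightarrow> (seminorm_of A x)\<^sup>2 = A x x"
  by (simp add: seminorm_of_def positive_semidefinite_def)

lemma seminorm_of_nonneg: "positive_semidefinite A \<Longrightarrow> 0 \<le> seminorm_of A x"
  by (simp add: seminorm_of_def positive_semidefinite_def)

text \<open>The situation at one fixed mesh parameter. The two parts of each discrete form are
  merged, so consistency (i) appears on the diagonal with the summed constants; the vectors
  \<open>y + z\<close> run through the sum of \<open>V\<close> and the extended eigenspace.\<close>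

locale perturbed_eigenproblem =
  fixes a b :: "'h::real_vector \<Rightarrow> 'h \<Rightarrow> real" and lam :: "nat \<Rightarrow> real" and u :: "nat \<Rightarrow> 'h"
    and E :: "'h \<Rightarrow> 'e::real_vector" and El :: "'e \<Rightarrow> 'h"
    and A B :: "'e \<Rightarrow> 'e \<Rightarrow> real" and V :: "'e set" and k :: nat
    and \<alpha> \<beta> t\<alpha> t\<beta> cF :: real
  assumes bil_a: "bilinear a" and bil_b: "bilinear b"
    and bil_A: "bilinear A" and sym_A: "symmetric_form A" and psd_A: "positive_semidefinite A"
    and bil_B: "bilinear B" and sym_B: "symmetric_form B" and psd_B: "positive_semidefinite B"
    and lin_El: "linear El" and El_E: "\<And>x. El (E x) = x"
    and lam_pos: "\<And>i. 1 \<le> i \<Longrightarrow> 0 < lam i"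
    and lam_mono: "\<And>i l. 1 \<le> i \<Longrightarrow> i \<le> l \<Longrightarrow> lam i \<le> lam l"
    and eig: "\<And>i v. 1 \<le> i \<Longrightarrow> a (u i) v = lam i * b (u i) v"
    and orth_b: "\<And>i l. 1 \<le> i \<Longrightarrow> 1 \<le> l \<Longrightarrow> b (u i) (u l) = (if i = l then 1 else 0)"
    and k_pos: "1 \<le> k" and V: "subspace V"
    and cons_a: "\<And>x. x \<in> span ((\<lambda>i. E (u i)) ` {1..k}) \<Longrightarrow>
      \<bar>A x x - a (El x) (El x)\<bar> \<le> \<alpha> * A x x"
    and cons_b: "\<And>x. x \<in> span ((\<lambda>i. E (u i)) ` {1..k}) \<Longrightarrow>
      \<bar>B x x - b (El x) (El x)\<bar> \<le> \<beta> * B x x"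
    and tcons_a: "\<And>x y z. x \<in> span ((\<lambda>i. E (u i)) ` {1..k}) \<Longrightarrow> y \<in> V \<Longrightarrow>
      z \<in> span ((\<lambda>i. E (u i)) ` {1..k}) \<Longrightarrow>
      \<bar>A x (y + z) - a (El x) (El (y + z))\<bar> \<le> t\<alpha> * seminorm_of A x * seminorm_of A (y + z)"
    and tcons_b: "\<And>x y z. x \<in> span ((\<lambda>i. E (u i)) ` {1..k}) \<Longrightarrow> y \<in> V \<Longrightarrow>
      z \<in> span ((\<lambda>i. E (u i)) ` {1..k}) \<Longrightarrow>
      \<bar>B x (y + z) - b (El x) (El (y + z))\<bar> \<le> t\<beta> * seminorm_of B x * seminorm_of B (y + z)"
    and \<alpha>_less: "\<alpha> < 1/2" and \<beta>_less: "\<beta> < 1/2"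
    and cF_pos: "0 < cF"
    and friedrichs: "\<And>y z. y \<in> V \<Longrightarrow> z \<in> span ((\<lambda>i. E (u i)) ` {1..k}) \<Longrightarrow>
      seminorm_of B (y + z) \<le> cF * seminorm_of A (y + z)"
begin

section \<open>Discrete and continuous forms on the extended eigenspaces\<close>

abbreviation U :: "nat \<Rightarrow> 'e set" where "U m \<equiv> span ((\<lambda>i. E (u i)) ` {1..m})"

text \<open>Bounds the factor by which a Rayleigh quotient on \<open>U k\<close> can grow in passing
  from \<open>a\<close>, \<open>b\<close> to \<open>A\<close>, \<open>B\<close>.\<close>

definition q :: real where "q = (1 + \<beta>) / (1 - \<alpha>)"

lemmas A_squared = seminorm_of_squared[OF psd_A] and B_squared = seminorm_of_squared[OF psd_B]
  and A_nonneg = seminorm_of_nonneg[OF psd_A] and B_nonneg = seminorm_of_nonneg[OF psd_B]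

lemma A_ge_0: "0 \<le> A x x" and B_ge_0: "0 \<le> B x x"
  using psd_A psd_B by (auto simp: positive_semidefinite_def)

lemma U_mono: "m \<le> k \<Longrightarrow> U m \<subseteq> U k"
  by (intro span_mono) auto

lemma zero_V: "0 \<in> V"
  using V by (rule subspace_0)

lemma El_sum: "El (\<Sum>i\<in>I. c i *\<^sub>R E (u i)) = (\<Sum>i\<in>I. c i *\<^sub>R u i)"
proof -
  interpret linear El by (rule lin_El)
  show ?thesis by (simp add: sum scale El_E)
qed

text \<open>The eigenvectors diagonalize both continuous forms at once, and \<open>El\<close> keeps
  coordinates because it inverts \<open>E\<close>.\<close>

lemma U_expand:
  assumes "x \<in> U m"
  obtains c where "x = (\<Sum>i\<in>{1..m}. c i *\<^sub>R E (u i))" "El x = (\<Sum>i\<in>{1..m}. c i *\<^sub>R u i)"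
    "a (El x) (El x) = (\<Sum>i\<in>{1..m}. lam i * (c i)\<^sup>2)"
    "b (El x) (El x) = (\<Sum>i\<in>{1..m}. (c i)\<^sup>2)"
proof -
  obtain c where c: "x = (\<Sum>i\<in>{1..m}. c i *\<^sub>R E (u i))"
    using assms span_image_sum[of "{1..m}" "\<lambda>i. E (u i)"] by auto
  have El: "El x = (\<Sum>i\<in>{1..m}. c i *\<^sub>R u i)" unfolding c by (rule El_sum)
  have "a (El x) (El x) = (\<Sum>i\<in>{1..m}. lam i * c i * c i)"
    unfolding El by (rule bilinear_sum_orthogonal[OF bil_a]) (auto simp: eig orth_b)
  moreover have "b (El x) (El x) = (\<Sum>i\<in>{1..m}. 1 * c i * c i)"
    unfolding El by (rule bilinear_sum_orthogonal[OF bil_b]) (auto simp: orth_b)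
  ultimately show thesis
    using that[of c] c El by (simp add: power2_eq_square mult.assoc)
qed

lemma u1_in: "E (u 1) \<in> U k"
  using k_pos by (intro span_base) auto

lemma u1_values: "a (El (E (u 1))) (El (E (u 1))) = lam 1" "b (El (E (u 1))) (El (E (u 1))) = 1"
  by (simp_all add: El_E eig orth_b)

text \<open>If the discrete value were 0, consistency would force the continuous one,
  \<open>lam 1\<close> or 1, to vanish as well.\<close>

lemma u1_pos: "0 < A (E (u 1)) (E (u 1))" "0 < B (E (u 1)) (E (u 1))"
  using cons_a[OF u1_in] cons_b[OF u1_in] A_ge_0[of "E (u 1)"] B_ge_0[of "E (u 1)"] lam_pos[of 1]
  unfolding u1_values by (auto simp: less_le)

text \<open>The signs are not assumed; they come from testing consistency with
  \<open>E (u 1)\<close>, where the left side is an absolute value.\<close>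

lemma \<alpha>_nonneg: "0 \<le> \<alpha>" and \<beta>_nonneg: "0 \<le> \<beta>"
proof -
  have "0 \<le> \<alpha> * A (E (u 1)) (E (u 1))" "0 \<le> \<beta> * B (E (u 1)) (E (u 1))"
    using cons_a[OF u1_in] cons_b[OF u1_in] by linarith+
  then show "0 \<le> \<alpha>" "0 \<le> \<beta>" using u1_pos by (simp_all add: zero_le_mult_iff)
qed

lemma t\<alpha>_nonneg: "0 \<le> t\<alpha>" and t\<beta>_nonneg: "0 \<le> t\<beta>"
proof -
  have "0 \<le> t\<alpha> * A (E (u 1)) (E (u 1))" "0 \<le> t\<beta> * B (E (u 1)) (E (u 1))"
    using tcons_a[OF u1_in zero_V u1_in] tcons_b[OF u1_in zero_V u1_in]
    by (simp_all add: mult.assoc A_squared B_squared flip: power2_eq_square)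
  then show "0 \<le> t\<alpha>" "0 \<le> t\<beta>" using u1_pos by (simp_all add: zero_le_mult_iff)
qed

lemma q_ge_1: "1 \<le> q"
  using \<alpha>_nonneg \<beta>_nonneg \<alpha>_less by (simp add: q_def field_simps)

lemma A_lower: "x \<in> U k \<Longrightarrow> (1 - \<alpha>) * A x x \<le> a (El x) (El x)"
  and A_upper: "x \<in> U k \<Longrightarrow> a (El x) (El x) \<le> (1 + \<alpha>) * A x x"
  and B_lower: "x \<in> U k \<Longrightarrow> (1 - \<beta>) * B x x \<le> b (El x) (El x)"
  and B_upper: "x \<in> U k \<Longrightarrow> b (El x) (El x) \<le> (1 + \<beta>) * B x x"
  using cons_a[of x] cons_b[of x] unfolding distrib_right left_diff_distrib by linarith+

text \<open>An inverse estimate, obtained by passing to the continuous forms, where it holds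
  coordinatewise since \<open>lam i \<le> lam m\<close>.\<close>

lemma A_le_lam_B:
  assumes m: "m \<le> k" and x: "x \<in> U m"
  shows "A x x \<le> lam m * q * B x x"
proof -
  have xk: "x \<in> U k" using U_mono[OF m] x by blast
  obtain c where c: "a (El x) (El x) = (\<Sum>i\<in>{1..m}. lam i * (c i)\<^sup>2)"
    "b (El x) (El x) = (\<Sum>i\<in>{1..m}. (c i)\<^sup>2)"
    using U_expand[OF x] by metis
  have "a (El x) (El x) \<le> lam m * b (El x) (El x)"
    unfolding c sum_distrib_left by (intro sum_mono mult_right_mono lam_mono) auto
  also have "\<dots> \<le> lam m * ((1 + \<beta>) * B x x)"
  proof (cases "m = 0")
    \<comment> \<open>\<open>lam 0\<close> has no prescribed sign, but \<open>U 0\<close> contains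
      only 0.\<close>
    case True
    then have "x = 0" using x by simp
    then show ?thesis
      using linear_0[OF lin_El] by (simp add: bilinear_lzero[OF bil_b] bilinear_lzero[OF bil_B])
  next
    case False
    then show ?thesis using B_upper[OF xk] lam_pos[of m] by (intro mult_left_mono) auto
  qed
  finally have "(1 - \<alpha>) * A x x \<le> lam m * ((1 + \<beta>) * B x x)"
    using A_lower[OF xk] by linarith
  then show ?thesis using \<alpha>_less by (simp add: q_def field_simps)
qed

text \<open>Makes the \<open>A\<close>-projection onto \<open>U m\<close> well defined: by
  \<open>A_upper\<close>, \<open>A x x = 0\<close> would contradict the coordinate formula for
  \<open>a (El x) (El x)\<close>.\<close>

lemma A_pos_U: "positive_definite_on (U k) A"
  unfolding positive_definite_on_def
proof (intro ballI impI)
  fix x assume x: "x \<in> U k" "x \<noteq> 0"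
  obtain c where c: "x = (\<Sum>i\<in>{1..k}. c i *\<^sub>R E (u i))"
    "a (El x) (El x) = (\<Sum>i\<in>{1..k}. lam i * (c i)\<^sup>2)"
    using U_expand[OF x(1)] by metis
  have "\<exists>i\<in>{1..k}. c i \<noteq> 0" by (rule ccontr) (use x(2)[unfolded c(1)] in simp)
  then obtain i where i: "i \<in> {1..k}" "c i \<noteq> 0" by blast
  have nn: "\<And>i. i \<in> {1..k} \<Longrightarrow> 0 \<le> lam i * (c i)\<^sup>2"
    using lam_pos by (simp add: less_imp_le)
  have "0 < lam i * (c i)\<^sup>2" using i lam_pos by simp
  then have "0 < a (El x) (El x)" unfolding c(2) using i(1) nn by (intro sum_pos2) auto
  then have "A x x \<noteq> 0" using A_upper[OF x(1)] by auto
  then show "0 < A x x" using A_ge_0[of x] by simp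
qed

text \<open>Friedrichs tested with the first eigenvector bounds \<open>1 / lam 1\<close> by
  \<open>cF\<^sup>2 * q\<close>, so that later constants involve \<open>cF\<close> instead of
  \<open>lam 1\<close>.\<close>

lemma friedrichs_lam: "1 \<le> cF\<^sup>2 * lam 1 * q"
proof -
  let ?x = "E (u 1)"
  have "seminorm_of B ?x \<le> cF * seminorm_of A ?x"
    using friedrichs[OF zero_V u1_in] by simp
  then have "B ?x ?x \<le> cF\<^sup>2 * A ?x ?x"
    using power_mono[of "seminorm_of B ?x" "cF * seminorm_of A ?x" 2]
    by (simp add: B_nonneg power_mult_distrib A_squared B_squared)
  also have "\<dots> \<le> cF\<^sup>2 * (lam 1 * q * B ?x ?x)"
    by (intro mult_left_mono A_le_lam_B[OF k_pos]) (auto intro: span_base)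
  finally have "1 * B ?x ?x \<le> (cF\<^sup>2 * lam 1 * q) * B ?x ?x" by (simp add: mult.assoc)
  then show ?thesis using u1_pos(2) by (simp only: mult_le_cancel_right_pos)
qed

section \<open>The cross term by duality\<close>

text \<open>The solution operator of the continuous problem maps \<open>u\<^sub>i\<close> to \<open>u\<^sub>i / \<lambda>\<^sub>i\<close>, so it
  leaves the span of the first \<open>m\<close> eigenvectors invariant and the \<open>b\<close>-product can be
  rewritten as an \<open>a\<close>-product inside that span.\<close>

lemma solution_operator:
  assumes m: "m \<le> k" and x: "x \<in> U m"
  obtains y where "y \<in> U m" "\<And>v. a (El y) v = b (El x) v"
    "seminorm_of A y \<le> cF * q * seminorm_of B x"
proof -
  have xk: "x \<in> U k" using U_mono[OF m] x by blast
  obtain c where "x = (\<Sum>i\<in>{1..m}. c i *\<^sub>R E (u i))"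
    and "a (El x) (El x) = (\<Sum>i\<in>{1..m}. lam i * (c i)\<^sup>2)"
    and c: "El x = (\<Sum>i\<in>{1..m}. c i *\<^sub>R u i)"
      "b (El x) (El x) = (\<Sum>i\<in>{1..m}. (c i)\<^sup>2)"
    by (rule U_expand[OF x])
  define y where "y = (\<Sum>i\<in>{1..m}. (c i / lam i) *\<^sub>R E (u i))"
  have y: "y \<in> U m" unfolding y_def by (intro span_sum span_scale span_base) auto
  then have yk: "y \<in> U k" using U_mono[OF m] by blast
  have Ely: "El y = (\<Sum>i\<in>{1..m}. (c i / lam i) *\<^sub>R u i)" unfolding y_def by (rule El_sum)
  have lam_nz: "lam i \<noteq> 0" if "i \<in> {1..m}" for i using lam_pos[of i] that by auto
  \<comment> \<open>The eigenvalue equation holds against every \<open>v\<close>, so the identity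
    may be tested with vectors outside the eigenspaces, such as the lift of the projection
    error.\<close>
  have ab: "a (El y) v = b (El x) v" for v
    unfolding Ely c(1) bilinear_sum_left[OF bil_a] bilinear_sum_left[OF bil_b]
    using lam_nz by (intro sum.cong) (auto simp: eig)
  have "b (El x) (El y) = (\<Sum>i\<in>{1..m}. 1 * c i * (c i / lam i))"
    unfolding Ely c(1) by (rule bilinear_sum_orthogonal[OF bil_b]) (auto simp: orth_b)
  also have "\<dots> \<le> (\<Sum>i\<in>{1..m}. (c i)\<^sup>2 / lam 1)"
  proof (intro sum_mono)
    fix i assume "i \<in> {1..m}"
    then have "(c i)\<^sup>2 / lam i \<le> (c i)\<^sup>2 / lam 1"
      using lam_pos[of 1] lam_mono[of 1 i] by (intro divide_left_mono) auto
    then show "1 * c i * (c i / lam i) \<le> (c i)\<^sup>2 / lam 1" by (simp add: power2_eq_square)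
  qed
  also have "\<dots> = b (El x) (El x) / lam 1" by (simp add: c(2) sum_divide_distrib)
  also have "\<dots> \<le> (1 + \<beta>) * B x x / lam 1"
    using B_upper[OF xk] lam_pos[of 1] by (intro divide_right_mono) auto
  finally have "a (El y) (El y) \<le> (1 + \<beta>) * B x x / lam 1" by (simp add: ab)
  then have "(1 - \<alpha>) * A y y \<le> (1 + \<beta>) * B x x / lam 1" using A_lower[OF yk] by linarith
  then have "A y y \<le> (1 + \<beta>) * B x x / lam 1 / (1 - \<alpha>)"
    using \<alpha>_less by (subst pos_le_divide_eq) (auto simp: mult.commute)
  also have "\<dots> = 1 * (q * B x x / lam 1)" by (simp add: q_def)
  \<comment> \<open>The factor 1 is enlarged by \<open>friedrichs_lam\<close>, which cancels
    \<open>lam 1\<close>.\<close>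
  also have "\<dots> \<le> (cF\<^sup>2 * lam 1 * q) * (q * B x x / lam 1)"
    using B_ge_0[of x] lam_pos[of 1] q_ge_1
    by (intro mult_right_mono[OF friedrichs_lam]) auto
  also have "\<dots> = (cF * q * seminorm_of B x)\<^sup>2"
    using lam_pos[of 1] by (simp only: power_mult_distrib B_squared) (simp add: power2_eq_square)
  finally have "seminorm_of A y \<le> cF * q * seminorm_of B x"
    using cF_pos q_ge_1 B_nonneg[of x]
    by (intro power2_le_imp_le[of "seminorm_of A y"] mult_nonneg_nonneg) (auto simp: A_squared)
  then show thesis using that y ab by blast
qed

text \<open>\<open>B x r\<close> is close to \<open>b (El x) (El r) = a (El s) (El r)\<close>, which
  is close to \<open>A s r = 0\<close>; the two replacements contribute \<open>t\<beta>\<close> and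
  \<open>t\<alpha>\<close>.\<close>

lemma almost_orthogonal:
  assumes m: "m \<le> k" and x: "x \<in> U m" and r: "r = y + z" "y \<in> V" "z \<in> U k"
    and orth: "\<And>v. v \<in> U m \<Longrightarrow> A v r = 0"
  shows "\<bar>B x r\<bar> \<le> (t\<alpha> + t\<beta>) * q * cF * seminorm_of B x * seminorm_of A r"
proof -
  have xk: "x \<in> U k" using U_mono[OF m] x by blast
  obtain s where s: "s \<in> U m" "\<And>v. a (El s) v = b (El x) v"
    "seminorm_of A s \<le> cF * q * seminorm_of B x"
    using solution_operator[OF m x] by metis
  have sk: "s \<in> U k" using U_mono[OF m] s(1) by blast
  have "\<bar>b (El x) (El r)\<bar> \<le> t\<alpha> * seminorm_of A s * seminorm_of A r"
    using tcons_a[OF sk r(2,3)] orth[OF s(1)] by (simp add: r(1) s(2))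
  also have "\<dots> \<le> t\<alpha> * (cF * q * seminorm_of B x) * seminorm_of A r"
    by (intro mult_right_mono mult_left_mono s(3) t\<alpha>_nonneg A_nonneg)
  finally have 1: "\<bar>b (El x) (El r)\<bar> \<le> t\<alpha> * (cF * q * seminorm_of B x) * seminorm_of A r" .
  have "\<bar>B x r - b (El x) (El r)\<bar> \<le> t\<beta> * seminorm_of B x * seminorm_of B r"
    using tcons_b[OF xk r(2,3)] by (simp add: r(1))
  also have "\<dots> \<le> t\<beta> * seminorm_of B x * (cF * seminorm_of A r)"
    using friedrichs[OF r(2,3)] t\<beta>_nonneg B_nonneg[of x] by (intro mult_left_mono) (auto simp: r(1))
  \<comment> \<open>Inserting \<open>q \<ge> 1\<close> gives both errors the same constant.\<close>
  also have "\<dots> = 1 * (t\<beta> * seminorm_of B x * (cF * seminorm_of A r))" by simp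
  also have "\<dots> \<le> q * (t\<beta> * seminorm_of B x * (cF * seminorm_of A r))"
    using cF_pos t\<beta>_nonneg B_nonneg[of x] A_nonneg[of r] q_ge_1
    by (intro mult_right_mono mult_nonneg_nonneg) auto
  finally have "\<bar>B x r\<bar> \<le> t\<alpha> * (cF * q * seminorm_of B x) * seminorm_of A r
      + q * (t\<beta> * seminorm_of B x * (cF * seminorm_of A r))"
    using 1 by linarith
  also have "\<dots> = t\<alpha> * (q * cF * seminorm_of B x * seminorm_of A r)
      + t\<beta> * (q * cF * seminorm_of B x * seminorm_of A r)"
    by (simp only: mult_ac)
  also have "\<dots> = (t\<alpha> + t\<beta>) * q * cF * seminorm_of B x * seminorm_of A r"
    by (simp only: distrib_right[symmetric] mult.assoc)
  finally show ?thesis .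
qed

text \<open>The Rayleigh quotient argument. Consistency (i) gives the factors in \<alpha> and
  \<beta>, the cross term \<open>B x r\<close> gives \<open>1 + \<delta>\<close>, and
  \<open>B r r\<close> gives the factor with \<Lambda>.\<close>

lemma eigenvalue_lower_bound:
  fixes tlam :: "nat \<Rightarrow> real" and tu :: "nat \<Rightarrow> 'e" and \<Phi> \<delta> \<Lambda> :: real
  assumes \<Phi>_def: "\<Phi> = projection_defect A (U m) (span (tu ` {1..m}))"
    and \<delta>_def: "\<delta> = 8 / sqrt 3 * cF * sqrt (lam k) * (t\<alpha> + t\<beta>) * \<Phi>"
    and j: "1 \<le> j" "j \<le> m" and m: "m \<le> k"
    and tu_V: "\<And>i. i \<in> {1..m} \<Longrightarrow> tu i \<in> V"
    and A_pos: "positive_definite_on V A"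
    and orth_A: "\<And>i l. i \<in> {1..m} \<Longrightarrow> l \<in> {1..m} \<Longrightarrow> A (tu i) (tu l) = (if i = l then tlam i else 0)"
    and orth_B: "\<And>i l. i \<in> {1..m} \<Longrightarrow> l \<in> {1..m} \<Longrightarrow> B (tu i) (tu l) = (if i = l then 1 else 0)"
    and tlam_mono: "\<And>i. i \<in> {1..j} \<Longrightarrow> tlam i \<le> tlam j" and \<Lambda>: "tlam j \<le> \<Lambda>"
    and \<Phi>_half: "\<Phi> \<le> 1/2"
  shows "(1 - 2 * \<alpha>) * (1 - 2 * \<beta>) * (1 + \<delta>) powi (-2) * (1 - cF\<^sup>2 * \<Lambda> * \<Phi>\<^sup>2) * lam j
      \<le> tlam j"
proof -
  have U_k: "U m \<subseteq> U k" by (rule U_mono[OF m])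
  interpret P: form_projector A "(\<lambda>i. E (u i)) ` {1..m}"
    using bil_A sym_A psd_A A_pos_U U_k
    by unfold_locales (auto simp: positive_definite_on_def)
  \<comment> \<open>The conditions \<open>i < j\<close> give \<open>j - 1\<close> equations for
    \<open>j\<close> coefficients.\<close>
  define M where "M = (\<lambda>i l. b (u i) (El (P.P (tu l))))"
  have "card {1..<j} < card {1..j}" using j by simp
  then obtain d where d: "\<exists>l\<in>{1..j}. d l \<noteq> 0"
      "\<And>i. i \<in> {1..<j} \<Longrightarrow> (\<Sum>l\<in>{1..j}. d l * M i l) = 0"
    using underdetermined_system[OF finite_atLeastLessThan finite_atLeastAtMost, of 1 j 1 j M]
    by blast
  define w where "w = (\<Sum>l\<in>{1..j}. d l *\<^sub>R tu l)"
  define x where "x = P.P w"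
  define r where "r = w - x"
  have x_in: "x \<in> U m" unfolding x_def by (rule P.P_in)
  then have xk: "x \<in> U k" using U_k by blast
  have w_V: "w \<in> V" unfolding w_def using tu_V j V by (intro subspace_sum subspace_scale) auto
  have w_span: "w \<in> span (tu ` {1..m})"
    unfolding w_def using j by (intro span_sum span_scale span_base) auto
  have "A w w = (\<Sum>l\<in>{1..j}. tlam l * d l * d l)"
    unfolding w_def by (rule bilinear_sum_orthogonal[OF bil_A]) (use j orth_A in auto)
  also have "\<dots> \<le> (\<Sum>l\<in>{1..j}. tlam j * (d l)\<^sup>2)"
    using tlam_mono by (intro sum_mono) (auto simp: power2_eq_square mult.assoc intro: mult_right_mono)
  finally have Aw: "A w w \<le> tlam j * (\<Sum>l\<in>{1..j}. (d l)\<^sup>2)" by (simp add: sum_distrib_left)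
  have "B w w = (\<Sum>l\<in>{1..j}. 1 * d l * d l)"
    unfolding w_def by (rule bilinear_sum_orthogonal[OF bil_B]) (use j orth_B in auto)
  then have Bw: "B w w = (\<Sum>l\<in>{1..j}. (d l)\<^sup>2)" by (simp add: power2_eq_square)
  obtain l where "l \<in> {1..j}" "d l \<noteq> 0" using d(1) by blast
  then have Bw_pos: "0 < B w w" unfolding Bw by (intro sum_pos2[of _ l]) auto
  then have w_nz: "w \<noteq> 0" using bilinear_lzero[OF bil_B] by force

  have "b (u i) (El x) = 0" if "i \<in> {1..<j}" for i
  proof -
    interpret linear El by (rule lin_El)
    have "El x = (\<Sum>l\<in>{1..j}. d l *\<^sub>R El (P.P (tu l)))"
      by (simp only: x_def w_def P.P_sum sum scale)
    then show ?thesis using d(2)[OF that] by (simp add: bilinear_sum_right[OF bil_b] M_def)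
  qed
  moreover obtain c where "x = (\<Sum>i\<in>{1..m}. c i *\<^sub>R E (u i))"
    and c: "El x = (\<Sum>i\<in>{1..m}. c i *\<^sub>R u i)"
      "a (El x) (El x) = (\<Sum>i\<in>{1..m}. lam i * (c i)\<^sup>2)"
      "b (El x) (El x) = (\<Sum>i\<in>{1..m}. (c i)\<^sup>2)"
    by (rule U_expand[OF x_in])
  moreover have "b (u i) (El x) = c i" if "i \<in> {1..m}" for i
  proof -
    have "b (u i) (El x) = (\<Sum>l\<in>{1..m}. if l = i then c i else 0)"
      unfolding c(1) bilinear_sum_right[OF bil_b] using that by (intro sum.cong) (auto simp: orth_b)
    then show ?thesis using that by simp
  qed
  ultimately have c0: "c i = 0" if "i \<in> {1..<j}" for i using that j by auto
  \<comment> \<open>The first \<open>j - 1\<close> coordinates vanish, so only eigenvalues from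
    \<open>lam j\<close> upwards contribute.\<close>
  have "lam j * b (El x) (El x) \<le> a (El x) (El x)"
    unfolding c(2,3) sum_distrib_left
  proof (intro sum_mono)
    fix i assume i: "i \<in> {1..m}"
    show "lam j * (c i)\<^sup>2 \<le> lam i * (c i)\<^sup>2"
      using c0[of i] i j lam_mono[of j i] by (cases "i < j") (auto intro: mult_right_mono)
  qed
  moreover have "lam j * ((1 - \<beta>) * B x x) \<le> lam j * b (El x) (El x)"
    using B_lower[OF xk] lam_pos[OF j(1)] by (intro mult_left_mono) auto
  moreover have "A x x \<le> tlam j * B w w"
    using P.P_pythagoras[of w] A_ge_0[of "w - x"] Aw by (simp add: x_def Bw)
  then have "(1 + \<alpha>) * A x x \<le> (1 + \<alpha>) * (tlam j * B w w)"
    using \<alpha>_nonneg by (intro mult_left_mono) auto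
  \<comment> \<open>What remains is to bound \<open>B w w\<close> by \<open>B x x\<close>.\<close>
  ultimately have rayleigh: "lam j * ((1 - \<beta>) * B x x) \<le> (1 + \<alpha>) * (tlam j * B w w)"
    using A_upper[OF xk] by linarith

  have W_pos: "positive_definite_on (span (tu ` {1..m})) A"
  proof -
    have "span (tu ` {1..m}) \<subseteq> V" using tu_V V by (intro span_minimal) auto
    then show ?thesis using A_pos by (auto simp: positive_definite_on_def)
  qed
  have \<Phi>_nonneg: "0 \<le> \<Phi>"
    unfolding \<Phi>_def by (rule P.projection_defect_bound(2)[OF W_pos w_span w_nz])
  have r_w: "seminorm_of A r \<le> \<Phi> * seminorm_of A w"
    unfolding \<Phi>_def r_def x_def by (rule P.projection_defect_bound(1)[OF W_pos w_span w_nz])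
  then have "(seminorm_of A r)\<^sup>2 \<le> (\<Phi> * seminorm_of A w)\<^sup>2"
    by (intro power_mono A_nonneg)
  then have Ar: "A r r \<le> \<Phi>\<^sup>2 * A w w" by (simp add: A_squared power_mult_distrib)
  have "\<Phi>\<^sup>2 \<le> (1/2)\<^sup>2" using \<Phi>_half \<Phi>_nonneg by (intro power_mono)
  then have "\<Phi>\<^sup>2 * A w w \<le> 1/4 * A w w"
    by (intro mult_right_mono A_ge_0) (simp add: power2_eq_square)
  \<comment> \<open>From \<Phi> at most 1/2: the error carries at most a quarter of
    \<open>A w w\<close>, so the projection keeps three quarters. The root of 4/3 is the source of
    \<open>2 / sqrt 3\<close>.\<close>
  then have "A w w \<le> 4/3 * A x x"
    using Ar P.P_pythagoras[of w] by (simp add: r_def x_def)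
  also have "\<dots> \<le> 4/3 * (lam k * q * B x x)"
  proof -
    have "lam m * (q * B x x) \<le> lam k * (q * B x x)"
      using j m q_ge_1 B_ge_0[of x] by (intro mult_right_mono lam_mono mult_nonneg_nonneg) auto
    then show ?thesis using A_le_lam_B[OF m x_in] by (simp add: mult.assoc)
  qed
  also have "\<dots> = (2 / sqrt 3 * sqrt (lam k) * sqrt q * seminorm_of B x)\<^sup>2"
    using lam_pos[OF k_pos] q_ge_1 by (simp add: power_mult_distrib power_divide B_squared)
  finally have "(seminorm_of A w)\<^sup>2 \<le> (2 / sqrt 3 * sqrt (lam k) * sqrt q * seminorm_of B x)\<^sup>2"
    by (simp add: A_squared)
  then have "seminorm_of A w \<le> 2 / sqrt 3 * sqrt (lam k) * sqrt q * seminorm_of B x"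
    by (rule power2_le_imp_le) (use lam_pos[OF k_pos] q_ge_1 B_nonneg[of x] in auto)
  then have r_x: "seminorm_of A r \<le> \<Phi> * (2 / sqrt 3 * sqrt (lam k) * sqrt q * seminorm_of B x)"
    using r_w \<Phi>_nonneg by (meson mult_left_mono order_trans)

  have "\<bar>B x r\<bar> \<le> (t\<alpha> + t\<beta>) * q * cF * seminorm_of B x * seminorm_of A r"
  proof (rule almost_orthogonal[OF m x_in])
    \<comment> \<open>The splitting places \<open>r\<close> in the sum of \<open>V\<close> and
      \<open>U k\<close>, where consistency (ii) and Friedrichs apply.\<close>
    show "r = w + (- x)" by (simp add: r_def)
    show "- x \<in> U k" using xk by (rule span_neg)
    fix v assume "v \<in> U m"
    then have "A r v = 0" unfolding r_def x_def by (rule P.P_orth)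
    then show "A v r = 0" using sym_A by (simp add: symmetric_form_def)
  qed (rule w_V)
  also have "\<dots> \<le> (t\<alpha> + t\<beta>) * q * cF * seminorm_of B x
      * (\<Phi> * (2 / sqrt 3 * sqrt (lam k) * sqrt q * seminorm_of B x))"
    using t\<alpha>_nonneg t\<beta>_nonneg q_ge_1 cF_pos B_nonneg[of x]
    by (intro mult_left_mono r_x mult_nonneg_nonneg) auto
  \<comment> \<open>\<open>2 / sqrt 3\<close> is a quarter of the constant \<open>8 / sqrt 3\<close>
    in \<delta>.\<close>
  also have "\<dots> = (q * sqrt q) / 4 * \<delta> * (seminorm_of B x)\<^sup>2"
    by (simp add: \<delta>_def power2_eq_square)
  finally have Bxr: "\<bar>B x r\<bar> \<le> (q * sqrt q) / 4 * \<delta> * B x x" by (simp add: B_squared)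

  have "seminorm_of B r \<le> cF * seminorm_of A r"
    using friedrichs[OF w_V span_neg[OF xk]] by (simp add: r_def)
  then have "(seminorm_of B r)\<^sup>2 \<le> (cF * seminorm_of A r)\<^sup>2"
    by (intro power_mono B_nonneg)
  then have "B r r \<le> cF\<^sup>2 * A r r" by (simp add: A_squared B_squared power_mult_distrib)
  also have "\<dots> \<le> cF\<^sup>2 * (\<Phi>\<^sup>2 * A w w)" by (intro mult_left_mono Ar) simp
  also have "\<dots> \<le> cF\<^sup>2 * (\<Phi>\<^sup>2 * (\<Lambda> * B w w))"
  proof -
    have "tlam j * B w w \<le> \<Lambda> * B w w" by (intro mult_right_mono \<Lambda> B_ge_0)
    then show ?thesis using Aw by (intro mult_left_mono) (auto simp: Bw)
  qed
  finally have Br: "B r r \<le> cF\<^sup>2 * \<Lambda> * \<Phi>\<^sup>2 * B w w" by (simp add: mult_ac)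

  have "w = x + r" by (simp add: r_def)
  then have "B w w = B x x + B x r + B r x + B r r"
    by (simp add: bilinear_ladd[OF bil_B] bilinear_radd[OF bil_B])
  moreover have "B r x = B x r" using sym_B by (simp add: symmetric_form_def)
  \<comment> \<open>The cross term occurs twice, and the bound for \<open>B r r\<close> is absorbed
    on the left.\<close>
  ultimately have Bw_le: "(1 - cF\<^sup>2 * \<Lambda> * \<Phi>\<^sup>2) * B w w
      \<le> B x x + (q * sqrt q) / 2 * \<delta> * B x x"
    using Br Bxr by (simp add: left_diff_distrib)

  have \<delta>_nonneg: "0 \<le> \<delta>"
    using t\<alpha>_nonneg t\<beta>_nonneg cF_pos lam_pos[OF k_pos] \<Phi>_nonneg by (simp add: \<delta>_def)
  define \<kappa> where "\<kappa> = (1 - 2 * \<alpha>) * (1 - 2 * \<beta>) * (1 + \<alpha>)"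
  note \<kappa> = consistency_constants[OF \<alpha>_nonneg \<alpha>_less \<beta>_nonneg \<beta>_less, folded \<kappa>_def q_def]
  define \<theta> where "\<theta> = 1 - cF\<^sup>2 * \<Lambda> * \<Phi>\<^sup>2"
  \<comment> \<open>Since \<kappa> is positive, \<theta> may have either sign. The product of
    \<kappa> and \<open>q * sqrt q\<close> is then replaced by
    \<open>4 * (1 - \<beta>)\<close>.\<close>
  have "\<kappa> * (\<theta> * B w w) \<le> \<kappa> * (B x x + (q * sqrt q) / 2 * \<delta> * B x x)"
    using Bw_le \<kappa>(1) unfolding \<theta>_def by (intro mult_left_mono) auto
  also have "\<dots> = \<kappa> * B x x + (\<kappa> * (q * sqrt q)) * (\<delta> * B x x / 2)"
    by (simp add: distrib_left)
  also have "\<dots> \<le> (1 - \<beta>) * B x x + (4 * (1 - \<beta>)) * (\<delta> * B x x / 2)"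
    using \<kappa> \<delta>_nonneg B_ge_0[of x] by (intro add_mono mult_right_mono) auto
  \<comment> \<open>The bracket is now \<open>1 + 2 * \<delta>\<close>, which is completed to a
    square.\<close>
  also have "\<dots> \<le> (1 - \<beta>) * B x x * (1 + \<delta>)\<^sup>2"
  proof -
    have "0 \<le> (1 - \<beta>) * B x x * \<delta>\<^sup>2" using \<beta>_less B_ge_0[of x] by simp
    then show ?thesis by (simp add: power2_eq_square algebra_simps)
  qed
  finally have "lam j * (\<kappa> * (\<theta> * B w w)) \<le> lam j * ((1 - \<beta>) * B x x * (1 + \<delta>)\<^sup>2)"
    using lam_pos[OF j(1)] by (intro mult_left_mono) auto
  also have "\<dots> = lam j * ((1 - \<beta>) * B x x) * (1 + \<delta>)\<^sup>2" by simp
  also have "\<dots> \<le> (1 + \<alpha>) * (tlam j * B w w) * (1 + \<delta>)\<^sup>2"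
    by (intro mult_right_mono rayleigh) simp
  \<comment> \<open>The \<open>1 + \<alpha>\<close> contained in \<kappa> matches the one from
    \<open>rayleigh\<close>, so both cancel together with \<open>B w w\<close>.\<close>
  finally have "((1 - 2 * \<alpha>) * (1 - 2 * \<beta>) * \<theta> * lam j) * ((1 + \<alpha>) * B w w)
      \<le> (tlam j * (1 + \<delta>)\<^sup>2) * ((1 + \<alpha>) * B w w)"
    by (simp only: \<kappa>_def mult_ac)
  moreover have "0 < (1 + \<alpha>) * B w w" using \<alpha>_nonneg Bw_pos by simp
  ultimately have "(1 - 2 * \<alpha>) * (1 - 2 * \<beta>) * \<theta> * lam j \<le> tlam j * (1 + \<delta>)\<^sup>2"
    by (simp only: mult_le_cancel_right_pos)
  then have "(1 - 2 * \<alpha>) * (1 - 2 * \<beta>) * \<theta> * lam j / (1 + \<delta>)\<^sup>2 \<le> tlam j"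
    using \<delta>_nonneg by (simp add: pos_divide_le_eq)
  then show ?thesis
    by (simp add: \<theta>_def power_int_minus divide_inverse mult_ac)
qed

end

section \<open>Specialization to a fixed mesh parameter\<close>

theorem theorem5p8:
  fixes \<iota> :: "'h::{real_inner,complete_space} \<Rightarrow> 'k::{real_inner,complete_space}"
    and a b :: "'h \<Rightarrow> 'h \<Rightarrow> real"
    and lam :: "nat \<Rightarrow> real" and u :: "nat \<Rightarrow> 'h"
    and kmax :: nat
    and hs :: "real set"
    and E :: "'h \<Rightarrow> 'e::real_vector"
    and El :: "real \<Rightarrow> 'e \<Rightarrow> 'h"
    and V :: "real \<Rightarrow> 'e set" and n :: "real \<Rightarrow> nat"
    and ah ta ka bh tb kb :: "real \<Rightarrow> 'e \<Rightarrow> 'e \<Rightarrow> real"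
    and an bn :: "real \<Rightarrow> 'e \<Rightarrow> real"
    and tlam :: "real \<Rightarrow> nat \<Rightarrow> real" and tu :: "real \<Rightarrow> nat \<Rightarrow> 'e"
    and Ue :: "nat \<Rightarrow> 'e set" and tU :: "real \<Rightarrow> nat \<Rightarrow> 'e set"
    and \<alpha>1 \<alpha>2 \<beta>1 \<beta>2 \<alpha> \<beta> t\<alpha> t\<beta> :: "real \<Rightarrow> real"
    and cF chat :: real
    and \<Phi> :: "real \<Rightarrow> nat \<Rightarrow> real"
    and h :: real and m j :: nat
  \<comment> \<open>the continuous eigenvalue problem\<close>
  assumes "\<not> finite_dimensional (UNIV :: 'h set)" and "\<not> finite_dimensional (UNIV :: 'k set)"
    and "compact_embedding \<iota>"
    and "bounded_bilinear a" and "symmetric_form a" and "elliptic_form a"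
    and b_def: "\<And>x y. b x y = \<iota> x \<bullet> \<iota> y"
    and "\<And>k. 1 \<le> k \<Longrightarrow> 0 < lam k"
    and "\<And>k l. 1 \<le> k \<Longrightarrow> k \<le> l \<Longrightarrow> lam k \<le> lam l"
    and "filterlim lam at_top sequentially"
    and "\<And>\<mu>. card {k. 1 \<le> k \<and> lam k = \<mu>} = dim (eigenspace a b \<mu>)"
    and "\<And>k v. 1 \<le> k \<Longrightarrow> a (u k) v = lam k * b (u k) v"
    and "\<And>k l. 1 \<le> k \<Longrightarrow> 1 \<le> l \<Longrightarrow> a (u k) (u l) = (if k = l then lam k else 0)"
    and "\<And>k l. 1 \<le> k \<Longrightarrow> 1 \<le> l \<Longrightarrow> b (u k) (u l) = (if k = l then 1 else 0)"
  \<comment> \<open>extensions, discrete spaces and forms, for all mesh parameters in \<open>hs\<close>\<close>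
    and "hs \<subseteq> {0<..}"
    and "linear E" and "inj E"
    and Ue_def: "\<And>k. Ue k = span ((\<lambda>i. E (u i)) ` {1..k})"
    and "\<And>h. h \<in> hs \<Longrightarrow> linear (El h)" and "\<And>h x. h \<in> hs \<Longrightarrow> El h (E x) = x"
    and "\<And>h. h \<in> hs \<Longrightarrow> subspace (V h)" and "\<And>h. h \<in> hs \<Longrightarrow> finite_dimensional (V h)"
    and n_def: "\<And>h. n h = dim (V h)" and "\<And>h. h \<in> hs \<Longrightarrow> kmax \<le> n h"
    and forms: "\<And>h A. h \<in> hs \<Longrightarrow> A \<in> {ta h, ka h, tb h, kb h} \<Longrightarrow>
           bilinear A \<and> symmetric_form A \<and> positive_semidefinite A"
    and ah_def: "\<And>h x y. ah h x y = ta h x y + ka h x y"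
    and bh_def: "\<And>h x y. bh h x y = tb h x y + kb h x y"
    and "\<And>h. h \<in> hs \<Longrightarrow> positive_definite_on (V h) (ah h)"
    and "\<And>h. h \<in> hs \<Longrightarrow> positive_definite_on (V h) (bh h)"
    and an_def: "\<And>h x. an h x = seminorm_of (ah h) x"
    and bn_def: "\<And>h x. bn h x = seminorm_of (bh h) x"
  \<comment> \<open>the discrete eigenvalue problem\<close>
    and "\<And>h. h \<in> hs \<Longrightarrow> inj_on (tu h) {1..n h} \<and> independent (tu h ` {1..n h}) \<and>
           span (tu h ` {1..n h}) = V h"
    and "\<And>h k. h \<in> hs \<Longrightarrow> k \<in> {1..n h} \<Longrightarrow> 0 < tlam h k"
    and "\<And>h k l. h \<in> hs \<Longrightarrow> k \<in> {1..n h} \<Longrightarrow> l \<in> {1..n h} \<Longrightarrow> k \<le> l \<Longrightarrow> tlam h k \<le> tlam h l"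
    and "\<And>h k l. h \<in> hs \<Longrightarrow> k \<in> {1..n h} \<Longrightarrow> l \<in> {1..n h} \<Longrightarrow>
           ah h (tu h k) (tu h l) = (if k = l then tlam h k else 0)"
    and "\<And>h k l. h \<in> hs \<Longrightarrow> k \<in> {1..n h} \<Longrightarrow> l \<in> {1..n h} \<Longrightarrow>
           bh h (tu h k) (tu h l) = (if k = l then 1 else 0)"
    and tU_def: "\<And>h k. tU h k = span (tu h ` {1..k})"
  \<comment> \<open>consistency (i)\<close>
    and "\<And>h. h \<in> hs \<Longrightarrow> \<alpha>1 h < 1 \<and> \<alpha>2 h < 1 \<and> \<beta>1 h < 1 \<and> \<beta>2 h < 1"
    and "(\<alpha>1 \<longlongrightarrow> 0) (at 0 within hs)" and "(\<alpha>2 \<longlongrightarrow> 0) (at 0 within hs)"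
    and "(\<beta>1 \<longlongrightarrow> 0) (at 0 within hs)" and "(\<beta>2 \<longlongrightarrow> 0) (at 0 within hs)"
    and "\<And>h x y. h \<in> hs \<Longrightarrow> x \<in> Ue kmax \<Longrightarrow> y \<in> Ue kmax \<Longrightarrow>
           \<bar>ta h x y - a (El h x) (El h y)\<bar> \<le> \<alpha>1 h * an h x * an h y"
    and "\<And>h x y. h \<in> hs \<Longrightarrow> x \<in> Ue kmax \<Longrightarrow> y \<in> Ue kmax \<Longrightarrow>
           \<bar>ka h x y\<bar> \<le> \<alpha>2 h * an h x * an h y"
    and "\<And>h x y. h \<in> hs \<Longrightarrow> x \<in> Ue kmax \<Longrightarrow> y \<in> Ue kmax \<Longrightarrow>
           \<bar>tb h x y - b (El h x) (El h y)\<bar> \<le> \<beta>1 h * bn h x * bn h y"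
    and "\<And>h x y. h \<in> hs \<Longrightarrow> x \<in> Ue kmax \<Longrightarrow> y \<in> Ue kmax \<Longrightarrow>
           \<bar>kb h x y\<bar> \<le> \<beta>2 h * bn h x * bn h y"
    and \<alpha>_def: "\<And>h. \<alpha> h = \<alpha>1 h + \<alpha>2 h" and \<beta>_def: "\<And>h. \<beta> h = \<beta>1 h + \<beta>2 h"
  \<comment> \<open>consistency (ii)\<close>
    and "\<And>h. h \<in> hs \<Longrightarrow> t\<alpha> h < 1 \<and> t\<beta> h < 1"
    and "(t\<alpha> \<longlongrightarrow> 0) (at 0 within hs)" and "(t\<beta> \<longlongrightarrow> 0) (at 0 within hs)"
    and "\<And>h x y z. h \<in> hs \<Longrightarrow> x \<in> Ue kmax \<Longrightarrow> y \<in> V h \<Longrightarrow> z \<in> Ue kmax \<Longrightarrow>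
           \<bar>ah h x (y + z) - a (El h x) (El h (y + z))\<bar> \<le> t\<alpha> h * an h x * an h (y + z)"
    and "\<And>h x y z. h \<in> hs \<Longrightarrow> x \<in> Ue kmax \<Longrightarrow> y \<in> V h \<Longrightarrow> z \<in> Ue kmax \<Longrightarrow>
           \<bar>bh h x (y + z) - b (El h x) (El h (y + z))\<bar> \<le> t\<beta> h * bn h x * bn h (y + z)"
    and "\<And>h. h \<in> hs \<Longrightarrow> \<alpha> h < 1/2 \<and> \<beta> h < 1/2 \<and> t\<alpha> h < 1/2 \<and> t\<beta> h < 1/2"
  \<comment> \<open>Friedrichs\<close>
    and "0 < cF"
    and "\<And>h y z. h \<in> hs \<Longrightarrow> y \<in> V h \<Longrightarrow> z \<in> Ue kmax \<Longrightarrow> bn h (y + z) \<le> cF * an h (y + z)"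
    and \<Phi>_def: "\<And>h k. \<Phi> h k = projection_defect (ah h) (Ue k) (tU h k)"
    and chat_def: "chat = 8 / sqrt 3 * cF * sqrt (lam kmax)"
  \<comment> \<open>the hypotheses of the theorem proper\<close>
    and "h \<in> hs" and "1 \<le> m" and "m \<le> kmax"
    and "max (\<Phi> h m) (cF * tlam h kmax * \<Phi> h m) \<le> 1/2"
    and "1 \<le> j" and "j \<le> m"
  shows "tlam h j \<ge> (1 - 2 * \<alpha> h) * (1 - 2 * \<beta> h) *
           (1 + chat * (t\<alpha> h + t\<beta> h) * \<Phi> h m) powi (-2) *
           (1 - cF\<^sup>2 * tlam h kmax * (\<Phi> h m)\<^sup>2) * lam j"
proof -
  note h = \<open>h \<in> hs\<close>
  have kmax: "1 \<le> kmax" using \<open>1 \<le> m\<close> \<open>m \<le> kmax\<close> by simp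
  have V_span: "span (tu h ` {1..n h}) = V h" using assms(32)[OF h] by blast
  have ah: "bilinear (ah h)" "symmetric_form (ah h)" "positive_semidefinite (ah h)"
    using forms[OF h, of "ta h"] forms[OF h, of "ka h"]
    by (auto simp: ah_def bilinear_def symmetric_form_def positive_semidefinite_def linear_iff algebra_simps)
  have bh: "bilinear (bh h)" "symmetric_form (bh h)" "positive_semidefinite (bh h)"
    using forms[OF h, of "tb h"] forms[OF h, of "kb h"]
    by (auto simp: bh_def bilinear_def symmetric_form_def positive_semidefinite_def linear_iff algebra_simps)
  have lin_\<iota>: "linear \<iota>"
    using \<open>compact_embedding \<iota>\<close> by (simp add: compact_embedding_def bounded_linear.linear)
  have bil_b: "bilinear b"
    using lin_\<iota> by (auto simp: bilinear_def b_def linear_iff inner_add_left inner_add_right)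
  have bil_a: "bilinear a"
    using \<open>bounded_bilinear a\<close>
    by (auto simp: bilinear_def linear_iff bounded_bilinear.add_left bounded_bilinear.add_right
        bounded_bilinear.scaleR_left bounded_bilinear.scaleR_right)
  have an_sq: "an h x * an h x = ah h x x" for x
    using seminorm_of_squared[OF ah(3)] by (simp add: an_def power2_eq_square)
  have bn_sq: "bn h x * bn h x = bh h x x" for x
    using seminorm_of_squared[OF bh(3)] by (simp add: bn_def power2_eq_square)
  \<comment> \<open>The triangle inequality adds the errors of the two parts of the form; on the
    diagonal the product of norms is the form itself.\<close>
  have cons_a: "\<bar>ah h x x - a (El h x) (El h x)\<bar> \<le> \<alpha> h * ah h x x" if "x \<in> Ue kmax" for x
    using assms(43)[OF h that that] assms(44)[OF h that that]
    by (simp add: ah_def[of h x x] \<alpha>_def mult.assoc an_sq distrib_right)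
  have cons_b: "\<bar>bh h x x - b (El h x) (El h x)\<bar> \<le> \<beta> h * bh h x x" if "x \<in> Ue kmax" for x
    using assms(45)[OF h that that] assms(46)[OF h that that]
    by (simp add: bh_def[of h x x] \<beta>_def mult.assoc bn_sq distrib_right)
  interpret perturbed_eigenproblem a b lam u E "El h" "ah h" "bh h" "V h" kmax
    "\<alpha> h" "\<beta> h" "t\<alpha> h" "t\<beta> h" cF
  proof (rule perturbed_eigenproblem.intro)
    fix x y z :: 'e
    assume "x \<in> span ((\<lambda>i. E (u i)) ` {1..kmax})" "y \<in> V h"
      "z \<in> span ((\<lambda>i. E (u i)) ` {1..kmax})"
    then show "\<bar>ah h x (y + z) - a (El h x) (El h (y + z))\<bar>
        \<le> t\<alpha> h * seminorm_of (ah h) x * seminorm_of (ah h) (y + z)"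
      and "\<bar>bh h x (y + z) - b (El h x) (El h (y + z))\<bar>
        \<le> t\<beta> h * seminorm_of (bh h) x * seminorm_of (bh h) (y + z)"
      using assms(52)[OF h, of x y z] assms(53)[OF h, of x y z] by (simp_all add: Ue_def an_def bn_def)
  next
    fix y z :: 'e
    assume "y \<in> V h" "z \<in> span ((\<lambda>i. E (u i)) ` {1..kmax})"
    then show "seminorm_of (bh h) (y + z) \<le> cF * seminorm_of (ah h) (y + z)"
      using assms(56)[OF h, of y z] by (simp add: Ue_def an_def bn_def)
  next
    show "\<And>x. El h (E x) = x" by (rule assms(20)[OF h])
    show "\<And>i. 1 \<le> i \<Longrightarrow> 0 < lam i" by (rule assms(8))
    show "\<And>i l. 1 \<le> i \<Longrightarrow> i \<le> l \<Longrightarrow> lam i \<le> lam l" by (rule assms(9))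
    show "\<And>i v. 1 \<le> i \<Longrightarrow> a (u i) v = lam i * b (u i) v" by (rule assms(12))
    show "\<And>i l. 1 \<le> i \<Longrightarrow> 1 \<le> l \<Longrightarrow> b (u i) (u l) = (if i = l then 1 else 0)"
      by (rule assms(14))
    show "linear (El h)" by (rule assms(19)[OF h])
    show "subspace (V h)" by (rule assms(21)[OF h])
    show "\<alpha> h < 1/2" "\<beta> h < 1/2" using assms(54)[OF h] by auto
    show "0 < cF" by (rule assms(55))
  qed (use ah bh bil_a bil_b kmax cons_a cons_b in \<open>simp_all only: Ue_def\<close>)
  \<comment> \<open>Indices up to \<open>m\<close> stay within the discrete spectrum because
    \<open>kmax \<le> n h\<close>.\<close>
  have mn: "{1..m} \<subseteq> {1..n h}" using \<open>m \<le> kmax\<close> assms(24)[OF h] by auto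
  show ?thesis
  proof (rule eigenvalue_lower_bound[where m = m and tu = "tu h"])
    show "\<Phi> h m = projection_defect (ah h) (U m) (span (tu h ` {1..m}))"
      by (simp only: \<Phi>_def Ue_def tU_def)
    show "chat * (t\<alpha> h + t\<beta> h) * \<Phi> h m
        = 8 / sqrt 3 * cF * sqrt (lam kmax) * (t\<alpha> h + t\<beta> h) * \<Phi> h m"
      by (simp only: chat_def)
    show "tu h i \<in> V h" if "i \<in> {1..m}" for i
      unfolding V_span[symmetric] by (intro span_base imageI subsetD[OF mn that])
    show "ah h (tu h i) (tu h l) = (if i = l then tlam h i else 0)"
      if "i \<in> {1..m}" "l \<in> {1..m}" for i l
      by (rule assms(35)[OF h subsetD[OF mn that(1)] subsetD[OF mn that(2)]])
    show "bh h (tu h i) (tu h l) = (if i = l then 1 else 0)"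
      if "i \<in> {1..m}" "l \<in> {1..m}" for i l
      by (rule assms(36)[OF h subsetD[OF mn that(1)] subsetD[OF mn that(2)]])
    show "tlam h i \<le> tlam h j" if "i \<in> {1..j}" for i
      using assms(34)[OF h, of i j] assms(24)[OF h] that \<open>j \<le> m\<close> \<open>m \<le> kmax\<close> by auto
    \<comment> \<open>This fixes \<Lambda> as \<open>tlam h kmax\<close>.\<close>
    show "tlam h j \<le> tlam h kmax"
      using assms(34)[OF h, of j kmax] assms(24)[OF h] \<open>1 \<le> j\<close> \<open>j \<le> m\<close> \<open>m \<le> kmax\<close> by auto
    show "\<Phi> h m \<le> 1/2" using assms(62) by simp
  qed (use \<open>1 \<le> j\<close> \<open>j \<le> m\<close> \<open>m \<le> kmax\<close> assms(28)[OF h] in auto)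
qed

end
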